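(* Let $G$ be a graph and let $H_1,\dots,H_n$ be subgraphs of $G$ whose union is $G$ such that every edge of $G$ belongs to exactly $l$ of the $H_i$ (for some positive integer $l$). Suppose that for each $i$, $H_i$ admits an $\mathbb{S}^{j_i}$-flow. Then $G$ admits an $\mathbb{S}^{\,j_1+\cdots+j_n+n-1}$-flow.
   Context: For a nonnegative integer $d$, an $\mathbb{S}^d$-flow of a graph is a map from the edges of some orientation of the graph to unit vectors of $\mathbb{R}^{d+1}$ (Euclidean norm) such that at every vertex the sum of values on outgoing edges equals the sum on incoming edges (loops ignored). *)

theory Defs
  imports "HOL-Analysis.Abstract_Euclidean_Space" "Graph_Theory.Digraph"
begin

text \<open>Undirected graphs, with loops and parallel edges allowed. An edge has two distinct ends, or a
  single one if it is a loop.\<close>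

record ('v, 'e) multigraph =
  mverts :: "'v set"
  medges :: "'e set"
  mends :: "'e \<Rightarrow> 'v set"

definition wf_multigraph :: "('v, 'e) multigraph \<Rightarrow> bool" where
  "wf_multigraph G \<longleftrightarrow>
     (\<forall>e\<in>medges G. mends G e \<subseteq> mverts G \<and> card (mends G e) \<in> {1, 2})"

definition locally_finite_multigraph :: "('v, 'e) multigraph \<Rightarrow> bool" where
  "locally_finite_multigraph G \<longleftrightarrow> (\<forall>v\<in>mverts G. finite {e \<in> medges G. v \<in> mends G e})"

definition subgraph_of :: "('v, 'e) multigraph \<Rightarrow> ('v, 'e) multigraph \<Rightarrow> bool" where
  "subgraph_of H G \<longleftrightarrow>
     wf_multigraph H \<and> mverts H \<subseteq> mverts G \<and> medges H \<subseteq> medges G \<and>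
     (\<forall>e\<in>medges H. mends H e = mends G e)"

definition orientation_of :: "('v, 'e) pre_digraph \<Rightarrow> ('v, 'e) multigraph \<Rightarrow> bool" where
  "orientation_of D G \<longleftrightarrow>
     verts D = mverts G \<and> arcs D = medges G \<and>
     (\<forall>e\<in>medges G. {tail D e, head D e} = mends G e)"

text \<open>The library represents $\mathbb{R}^n$, for a varying dimension, by the functions
  \<^typ>\<open>nat \<Rightarrow> real\<close> vanishing from the index $n$ on; \<^term>\<open>nsphere d\<close> is the Euclidean unit
  sphere of $\mathbb{R}^{d+1}$ in this representation.\<close>

lemma in_nsphere_iff:
  "x \<in> topspace (nsphere d) \<longleftrightarrow> (\<forall>k>d. x k = 0) \<and> sqrt (\<Sum>k\<le>d. (x k)\<^sup>2) = 1"
  by (auto simp: nsphere topspace_Euclidean_space Suc_le_eq)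

text \<open>The conservation law is an equation between vectors, stated for each coordinate \<open>k\<close>. The sums
  are meaningful only when finitely many edges meet at \<open>v\<close>.\<close>

definition sphere_flow :: "nat \<Rightarrow> ('v, 'e) pre_digraph \<Rightarrow> ('e \<Rightarrow> nat \<Rightarrow> real) \<Rightarrow> bool" where
  "sphere_flow d D f \<longleftrightarrow>
     (\<forall>e\<in>arcs D. f e \<in> topspace (nsphere d)) \<and>
     (\<forall>v\<in>verts D. \<forall>k.
        (\<Sum>e\<in>{e \<in> out_arcs D v. tail D e \<noteq> head D e}. f e k) =
        (\<Sum>e\<in>{e \<in> in_arcs D v. tail D e \<noteq> head D e}. f e k))"

definition has_sphere_flow :: "nat \<Rightarrow> ('v, 'e) multigraph \<Rightarrow> bool" where
  "has_sphere_flow d G \<longleftrightarrow> (\<exists>D f. orientation_of D G \<and> sphere_flow d D f)"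

end

theory Submission
  imports Defs
begin

text \<open>Orient \<open>G\<close> arbitrarily. Reversing an edge and negating its value preserves a flow, so the flow of
  each \<open>H i\<close> can be carried over to that orientation and extended by zero to \<open>G\<close>. Concatenating these
  vectors over all \<open>i\<close> gives a flow in dimension \<open>(j 1 + 1) + \<dots> + (j n + 1)\<close>, in which every edge has
  squared norm \<open>l\<close>; dividing by \<open>sqrt l\<close> makes the values unit vectors.\<close>

text \<open>The index set depends on the graph alone, so conservation sums for different
  orientations can be compared term by term.\<close>

definition nonloops_at :: "('v, 'e) multigraph \<Rightarrow> 'v \<Rightarrow> 'e set" where
  "nonloops_at G v = {e \<in> medges G. v \<in> mends G e \<and> card (mends G e) = 2}"

text \<open>Entry of the signed incidence matrix, correct only for non-loop edges at
  \<open>v\<close>: every edge whose tail is not \<open>v\<close> gets -1, so it is used only in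
  sums over \<open>nonloops_at\<close>.\<close>

definition incidence :: "('v, 'e) pre_digraph \<Rightarrow> 'v \<Rightarrow> 'e \<Rightarrow> real" where
  "incidence D v e = (if tail D e = v then 1 else -1)"

lemma wf_multigraph_has_orientation:
  assumes "wf_multigraph G"
  obtains D :: "('v, 'e) pre_digraph" where "orientation_of D (G :: ('v, 'e) multigraph)"
proof -
  have "\<exists>a b. {a, b} = mends G e" if "e \<in> medges G" for e
    using assms that unfolding wf_multigraph_def
    by (metis card_1_singletonE card_2_iff insert_absorb2 insert_iff singletonD)
  then obtain t h where "\<And>e. e \<in> medges G \<Longrightarrow> {t e, h e} = mends G e"
    by metis
  then have "orientation_of \<lparr>verts = mverts G, arcs = medges G, tail = t, head = h\<rparr> G"
    by (simp add: orientation_of_def)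
  then show thesis
    by (rule that)
qed

text \<open>The non-loop arcs leaving \<open>v\<close> and those entering it partition
  \<open>nonloops_at G v\<close>, with incidence 1 on the former and -1 on the latter.\<close>

lemma conservation_iff_incidence_sum:
  fixes g :: "'e \<Rightarrow> real"
  assumes D: "orientation_of D G" and fin: "finite (nonloops_at G v)"
  shows "(\<Sum>e\<in>{e \<in> out_arcs D v. tail D e \<noteq> head D e}. g e) =
           (\<Sum>e\<in>{e \<in> in_arcs D v. tail D e \<noteq> head D e}. g e) \<longleftrightarrow>
         (\<Sum>e\<in>nonloops_at G v. incidence D v e * g e) = 0"
proof -
  let ?out = "{e \<in> out_arcs D v. tail D e \<noteq> head D e}"
  let ?in = "{e \<in> in_arcs D v. tail D e \<noteq> head D e}"
  have arcs: "arcs D = medges G" and ends: "\<And>e. e \<in> medges G \<Longrightarrow> mends G e = {tail D e, head D e}"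
    using D by (auto simp: orientation_of_def)
  have split: "nonloops_at G v = ?out \<union> ?in"
    using arcs ends by (auto simp: nonloops_at_def card_insert_if)
  have "(\<Sum>e\<in>nonloops_at G v. incidence D v e * g e) =
      (\<Sum>e\<in>?out. incidence D v e * g e) + (\<Sum>e\<in>?in. incidence D v e * g e)"
    unfolding split using fin split by (intro sum.union_disjoint) auto
  also have "\<dots> = sum g ?out + (\<Sum>e\<in>?in. - g e)"
    by (intro arg_cong2[of _ _ _ _ "(+)"] sum.cong) (auto simp: incidence_def)
  also have "\<dots> = sum g ?out - sum g ?in"
    by (simp add: sum_negf)
  finally show ?thesis
    by simp
qed

lemma sphere_flow_iff_incidence_sum:
  assumes "orientation_of D G" and "\<And>v. v \<in> mverts G \<Longrightarrow> finite (nonloops_at G v)"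
  shows "sphere_flow d D f \<longleftrightarrow>
    (\<forall>e\<in>medges G. f e \<in> topspace (nsphere d)) \<and>
    (\<forall>v\<in>mverts G. \<forall>k. (\<Sum>e\<in>nonloops_at G v. incidence D v e * f e k) = 0)"
proof -
  have "verts D = mverts G" "arcs D = medges G"
    using assms(1) by (auto simp: orientation_of_def)
  then show ?thesis
    unfolding sphere_flow_def using conservation_iff_incidence_sum[OF assms(1)] assms(2) by simp
qed

text \<open>A non-loop edge has just two orientations, told apart by the tail. If the tails differ,
  the edge is reversed, which flips its incidence at both ends.\<close>

lemma incidence_reorient:
  assumes "orientation_of D G" "orientation_of D' H" "subgraph_of H G" "e \<in> nonloops_at H v"
  shows "incidence D v e * (if tail D e = tail D' e then 1 else -1) = incidence D' v e"
proof -
  have e: "e \<in> medges H" "e \<in> medges G" and v: "v \<in> mends H e" and card: "card (mends H e) = 2"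
    and "mends G e = mends H e"
    using assms(3,4) by (auto simp: nonloops_at_def subgraph_of_def)
  then have D: "{tail D e, head D e} = mends H e" and D': "{tail D' e, head D' e} = mends H e"
    using assms(1,2) by (auto simp: orientation_of_def)
  have "tail D' e \<noteq> head D' e"
    using card unfolding D'[symmetric] by (auto simp: card_insert_if)
  moreover have "tail D e \<noteq> head D e"
    using card unfolding D[symmetric] by (auto simp: card_insert_if)
  moreover have "{tail D e, head D e} = {tail D' e, head D' e}" "v \<in> {tail D' e, head D' e}"
    using D D' v by simp_all
  ultimately show ?thesis
    unfolding incidence_def by (auto simp: doubleton_eq_iff)
qed

lemma nonloops_at_subgraph:
  assumes "subgraph_of H G"
  shows "nonloops_at H v = nonloops_at G v \<inter> medges H"
  using assms by (auto simp: nonloops_at_def subgraph_of_def)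

theorem theorem6p1:
  fixes G :: "('v, 'e) multigraph" and H :: "nat \<Rightarrow> ('v, 'e) multigraph"
    and n l :: nat and j :: "nat \<Rightarrow> nat"
  assumes "wf_multigraph G"
    and "locally_finite_multigraph G"
    and "n \<ge> 1"
    and "\<And>i. i \<in> {1..n} \<Longrightarrow> subgraph_of (H i) G"
    and "(\<Union>i\<in>{1..n}. mverts (H i)) = mverts G"
    and "(\<Union>i\<in>{1..n}. medges (H i)) = medges G"
    and "l \<ge> 1"
    and "\<And>e. e \<in> medges G \<Longrightarrow> card {i \<in> {1..n}. e \<in> medges (H i)} = l"
    and "\<And>i. i \<in> {1..n} \<Longrightarrow> has_sphere_flow (j i) (H i)"
  shows "has_sphere_flow ((\<Sum>i = 1..n. j i) + n - 1) G"
proof -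
  define d where "d = (\<Sum>i = 1..n. j i) + n - 1"
  have finG: "finite (nonloops_at G v)" if "v \<in> mverts G" for v
    using assms(2) that unfolding locally_finite_multigraph_def nonloops_at_def
    by (auto elim!: ballE intro: rev_finite_subset)
  have "\<forall>i\<in>{1..n}. \<exists>D f. orientation_of D (H i) \<and> sphere_flow (j i) D f"
    using assms(9) unfolding has_sphere_flow_def by blast
  then obtain D' f where D': "\<And>i. i \<in> {1..n} \<Longrightarrow> orientation_of (D' i) (H i)"
    and flow: "\<And>i. i \<in> {1..n} \<Longrightarrow> sphere_flow (j i) (D' i) (f i)"
    by metis
  have norm_f: "(\<Sum>m\<le>j i. (f i e m)\<^sup>2) = 1" if "i \<in> {1..n}" "e \<in> medges (H i)" for i e
    using flow[OF that(1)] D'[OF that(1)] that(2)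
    by (simp add: sphere_flow_def orientation_of_def in_nsphere_iff)
  \<comment> \<open>\<open>v\<close> is arbitrary here because a vertex of \<open>G\<close> may lie
    outside \<open>H i\<close>; no edge of \<open>H i\<close> meets it then, and the sum is
    empty.\<close>
  have cons_f: "(\<Sum>e\<in>nonloops_at (H i) v. incidence (D' i) v e * f i e m) = 0"
    if i: "i \<in> {1..n}" for i v m
  proof (cases "v \<in> mverts (H i)")
    case True
    have "finite (nonloops_at (H i) w)" if "w \<in> mverts (H i)" for w
      using nonloops_at_subgraph[OF assms(4)[OF i]] finG[of w] assms(4)[OF i] that
      by (auto simp: subgraph_of_def)
    from sphere_flow_iff_incidence_sum[OF D'[OF i] this] show ?thesis
      using flow[OF i] True by blast
  next
    case False
    then have "nonloops_at (H i) v = {}"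
      using assms(4)[OF i] by (auto simp: nonloops_at_def subgraph_of_def wf_multigraph_def)
    then show ?thesis
      by simp
  qed
  obtain D :: "('v, 'e) pre_digraph" where D: "orientation_of D G"
    using wf_multigraph_has_orientation[OF assms(1)] .

  \<comment> \<open>Both sides equal the sum of the \<open>j i + 1\<close>; \<open>n \<ge> 1\<close>
    makes the truncated subtraction in \<open>d\<close> exact.\<close>
  have "card {..d} = card (SIGMA i:{1..n}. {..j i})"
    using assms(3) by (simp add: d_def sum_Suc)
  \<comment> \<open>\<open>p\<close> lays out the concatenated coordinates:
    \<open>p k = (i, m)\<close> puts coordinate \<open>m\<close> of block \<open>i\<close> at
    position \<open>k\<close>. Their order affects neither norm nor conservation.\<close>
  then obtain p where p: "bij_betw p {..d} (SIGMA i:{1..n}. {..j i})"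
    using finite_same_card_bij[of "{..d}" "SIGMA i:{1..n}. {..j i}"] by auto

  \<comment> \<open>The sign carrying the value of \<open>e\<close> from the orientation
    \<open>D' i\<close> over to \<open>D\<close>. On loops either sign would do, since only its
    square matters.\<close>
  define s :: "nat \<Rightarrow> 'e \<Rightarrow> real"
    where "s i e = (if tail D e = tail (D' i) e then 1 else -1)" for i e
  define g where "g e i m = (if e \<in> medges (H i) then s i e * f i e m / sqrt l else 0)" for e i m
  \<comment> \<open>The value 0 beyond \<open>d\<close> is what membership in
    \<open>nsphere d\<close> demands.\<close>
  define F where "F e k = (if k \<le> d then case p k of (i, m) \<Rightarrow> g e i m else 0)" for e k

  have unit: "F e \<in> topspace (nsphere d)" if e: "e \<in> medges G" for e
  proof -
    \<comment> \<open>Squaring removes the sign and turns \<open>sqrt l\<close> into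
      \<open>l\<close>, so each \<open>H i\<close> containing \<open>e\<close> contributes
      \<open>1 / l\<close>; exactly \<open>l\<close> of them do.\<close>
    have block: "(\<Sum>m\<le>j i. (g e i m)\<^sup>2) = (if e \<in> medges (H i) then 1 / l else 0)"
      if "i \<in> {1..n}" for i
    proof -
      have "(\<Sum>m\<le>j i. (g e i m)\<^sup>2) = (\<Sum>m\<le>j i. (f i e m)\<^sup>2) / l" if "e \<in> medges (H i)"
        using that unfolding sum_divide_distrib
        by (intro sum.cong) (auto simp: g_def s_def power_mult_distrib power_divide)
      then show ?thesis
        using norm_f[OF that] by (auto simp: g_def)
    qed
    have "(\<Sum>k\<le>d. (F e k)\<^sup>2) = (\<Sum>k\<le>d. case p k of (i, m) \<Rightarrow> (g e i m)\<^sup>2)"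
      by (intro sum.cong) (auto simp: F_def split: prod.split)
    also have "\<dots> = (\<Sum>(i, m)\<in>(SIGMA i:{1..n}. {..j i}). (g e i m)\<^sup>2)"
      by (rule sum.reindex_bij_betw[OF p])
    also have "\<dots> = (\<Sum>i = 1..n. \<Sum>m\<le>j i. (g e i m)\<^sup>2)"
      by (intro sum.Sigma[symmetric]) auto
    also have "\<dots> = (\<Sum>i = 1..n. if e \<in> medges (H i) then 1 / l else 0)"
      by (intro sum.cong block) auto
    also have "\<dots> = (\<Sum>i\<in>{i \<in> {1..n}. e \<in> medges (H i)}. 1 / l)"
      by (intro sum.inter_filter[symmetric]) auto
    also have "\<dots> = 1"
      unfolding sum_constant assms(8)[OF e] using assms(7) by simp
    finally show ?thesis
      by (simp add: in_nsphere_iff F_def)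
  qed

  have cons: "(\<Sum>e\<in>nonloops_at G v. incidence D v e * F e k) = 0" if v: "v \<in> mverts G" for v k
  proof (cases "k \<le> d")
    case True
    \<comment> \<open>Coordinate \<open>k\<close> comes from the single block \<open>i\<close>, so
      conservation there reduces to that of \<open>f i\<close> in coordinate
      \<open>m\<close>.\<close>
    obtain i m where pk: "p k = (i, m)" and i: "i \<in> {1..n}"
      using bij_betwE[OF p] True by fastforce
    have "(\<Sum>e\<in>nonloops_at G v. incidence D v e * F e k) =
        (\<Sum>e\<in>nonloops_at G v.
          if e \<in> medges (H i) then incidence D v e * s i e * f i e m / sqrt l else 0)"
      using True by (intro sum.cong) (auto simp: F_def pk g_def)
    \<comment> \<open>Extension by zero leaves only the edges of \<open>H i\<close> in the
      sum.\<close>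
    also have "\<dots> = (\<Sum>e\<in>nonloops_at (H i) v. incidence D v e * s i e * f i e m / sqrt l)"
      unfolding nonloops_at_subgraph[OF assms(4)[OF i]]
      by (rule sum.inter_restrict[OF finG[OF v], symmetric])
    also have "\<dots> = (\<Sum>e\<in>nonloops_at (H i) v. incidence (D' i) v e * f i e m) / sqrt l"
      unfolding sum_divide_distrib s_def
      by (intro sum.cong) (simp_all only: incidence_reorient[OF D D'[OF i] assms(4)[OF i]])
    finally show ?thesis
      using cons_f[OF i] by simp
  qed (simp add: F_def)

  have "sphere_flow d D F"
    using sphere_flow_iff_incidence_sum[OF D finG] unit cons by blast
  then show ?thesis
    using D unfolding has_sphere_flow_def d_def by blast
qed

end
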